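(* In Mem$^0$, suppose that $m$ appears at least twice on the frontier, say as $\mathcal{G}(n_\infty)=\mathcal{G}(n'_\infty)=m$ with $0\le n<n'$. Then for every integer $a>2n'$ we have $\mathcal{G}(a_k)\neq m$ for all integers $k\ge 0$.
   Context: Mem$^0$ is an impartial game (normal play) on a heap of tokens. A position $n_k$ (integers $n,k\ge 0$) is a heap of $n$ tokens with memory $k$; from $n_k$ a player may move to $(n-j)_j$ for any integer $j$ with $1\le j\le n$ and $j\ne k$. The nim value is defined recursively by $\mathcal{G}(n_k)=\operatorname{mex}\{\mathcal{G}((n-j)_j) : 1\le j\le n,\ j\ne k\}$, where $\operatorname{mex}(S)$ is the least nonnegative integer not in $S$. For fixed $n$, the positions $n_{n+1},n_{n+2},\ldots$ all have the same options; each is denoted $n_\infty$, and $\mathcal{G}(n_\infty)$ (the common value of $\mathcal{G}(n_k)$ for $k\ge n+1$) is called the $n$th frontier value. *)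

theory Defs
  imports Main
begin

definition mex :: "nat set \<Rightarrow> nat" where
  "mex S = (LEAST m. m \<notin> S)"

text \<open>
  \<open>mem0_nim n k\<close> is the nim value of a heap of \<open>n\<close> tokens with memory \<open>k\<close>. The index \<open>j\<close> is the
  number of tokens removed, so the subtraction \<open>n - j\<close> is never truncated, and the option set is
  finite, so that \<^const>\<open>mex\<close> is well behaved.
\<close>

function mem0_nim :: "nat \<Rightarrow> nat \<Rightarrow> nat" where
  "mem0_nim n k = mex ((\<lambda>j. mem0_nim (n - j) j) ` {j. 1 \<le> j \<and> j \<le> n \<and> j \<noteq> k})"
  by auto
termination by (relation "measure fst") auto

declare mem0_nim.simps [simp del]

text \<open>
  The memory \<open>n + 1\<close> is a representative of the position \<open>n\<close> with memory \<open>\<infinity>\<close>; by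
  \<open>mem0_nim_eq_frontier\<close> below the choice of a memory exceeding \<open>n\<close> does not matter.
\<close>

definition mem0_frontier :: "nat \<Rightarrow> nat" where
  "mem0_frontier n = mem0_nim n (n + 1)"

lemma mem0_nim_eq_frontier:
  assumes "k \<ge> n + 1"
  shows "mem0_nim n k = mem0_frontier n"
proof -
  have "{j. 1 \<le> j \<and> j \<le> n \<and> j \<noteq> k} = {j. 1 \<le> j \<and> j \<le> n \<and> j \<noteq> n + 1}"
    using assms by auto
  then show ?thesis
    unfolding mem0_frontier_def mem0_nim.simps[of n k] mem0_nim.simps[of n "n + 1"] by simp
qed

end

theory Submission
  imports Defs
begin

text \<open>
  From a heap of \<open>a > 2 * i\<close> tokens, moving to \<open>i\<close> tokens removes \<open>a - i > i\<close> of them, so the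
  new memory is too large to restrict the next move and the option has the frontier value of \<open>i\<close>.
  A memory \<open>k\<close> forbids a single move size. If two heap sizes share the frontier value \<open>m\<close>, the
  moves to them have different sizes, so at least one remains legal: \<open>m\<close> is the value of an option,
  hence not the mex.
\<close>

lemma mex_notin:
  assumes "finite S"
  shows "mex S \<notin> S"
  unfolding mex_def by (rule LeastI_ex) (use assms in \<open>rule ex_new_if_finite[OF infinite_UNIV_nat]\<close>)

lemma mem0_nim_neq_option:
  assumes "1 \<le> j" "j \<le> n" "j \<noteq> k"
  shows "mem0_nim n k \<noteq> mem0_nim (n - j) j"
proof -
  let ?S = "(\<lambda>j. mem0_nim (n - j) j) ` {j. 1 \<le> j \<and> j \<le> n \<and> j \<noteq> k}"
  have "mem0_nim n k \<notin> ?S"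
    unfolding mem0_nim.simps[of n k] by (rule mex_notin) simp
  with assms show ?thesis by force
qed

lemma mem0_nim_neq_frontier:
  assumes "a > 2 * i" "k \<noteq> a - i"
  shows "mem0_nim a k \<noteq> mem0_frontier i"
proof -
  have "mem0_nim a k \<noteq> mem0_nim (a - (a - i)) (a - i)"
    using assms by (intro mem0_nim_neq_option) auto
  also have "mem0_nim (a - (a - i)) (a - i) = mem0_frontier i"
    using assms mem0_nim_eq_frontier[of i "a - i"] by simp
  finally show ?thesis .
qed

theorem theorem5p8:
  fixes m n n' :: nat
  assumes "n < n'"
    and "mem0_frontier n = m"
    and "mem0_frontier n' = m"
  shows "\<forall>a k :: nat. a > 2 * n' \<longrightarrow> mem0_nim a k \<noteq> m"
proof (intro allI impI)
  fix a k :: nat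
  assume a: "a > 2 * n'"
  then consider "k \<noteq> a - n" | "k \<noteq> a - n'"
    using assms(1) by linarith
  then show "mem0_nim a k \<noteq> m"
    using a assms mem0_nim_neq_frontier[of n a k] mem0_nim_neq_frontier[of n' a k]
    by cases auto
qed

end
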